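(* Let $X$ be a compact metric space and let $f : X \to X$ be a continuous map satisfying the specification property. Then there exists a Baire generic (residual) subset of points in $X$ with historic behavior, that is, of points $x\in X$ for which $\lim_{n \to +\infty} \frac1n\sum_{j=0}^{n-1} \delta_{f^j(x)}$ does not exist in the weak$^*$ topology.
   Context: Let $d$ denote the metric of $X$ and $\delta_z$ the Dirac probability measure at $z\in X$. The map $f$ satisfies the specification property if for every $\varepsilon>0$ there exists an integer $m(\varepsilon)\geqslant 1$ such that for every $k\geqslant 1$, all points $x_1,\dots,x_k\in X$, all integers $n_1,\dots,n_k\geqslant 0$ and all integers $p_1,\dots,p_{k-1}\geqslant m(\varepsilon)$ there exists $y\in X$ such that $d(f^j(y),f^j(x_1))\leqslant\varepsilon$ for every $0\leqslant j\leqslant n_1$ and $d\big(f^{\,j+n_1+p_1+\dots+n_{i-1}+p_{i-1}}(y),f^j(x_i)\big)\leqslant\varepsilon$ for every $2\leqslant i\leqslant k$ and $0\leqslant j\leqslant n_i$. A subset of a topological space is Baire residual (generic) if it contains a countable intersection of open dense subsets.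
   Formalization: The space X is assumed not to be a single point; on a one-point space the identity has specification but its only point has convergent averages, so the claim fails there. *)

theory Defs
  imports "HOL-Probability.Probability"
begin

text \<open>A space is given as a subset \<open>X\<close> of a type of class \<open>metric_space\<close>, with the
  induced metric, topology and Borel sigma-algebra; its self-maps are only relevant on \<open>X\<close>.\<close>

subsection \<open>The specification property\<close>

text \<open>The data \<open>x\<close>, \<open>n\<close>, \<open>p\<close> are sequences of which only the entries with indices in
  \<open>{1..k}\<close> (for \<open>p\<close>: in \<open>{1..<k}\<close>) matter.\<close>

definition specification_property :: "'a::metric_space set \<Rightarrow> ('a \<Rightarrow> 'a) \<Rightarrow> bool" where
  "specification_property X f \<longleftrightarrow>
    (\<forall>\<epsilon>>0. \<exists>m::nat. m \<ge> 1 \<and>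
      (\<forall>k\<ge>1. \<forall>(x :: nat \<Rightarrow> 'a) (n :: nat \<Rightarrow> nat) (p :: nat \<Rightarrow> nat).
        (\<forall>i\<in>{1..k}. x i \<in> X) \<longrightarrow> (\<forall>i\<in>{1..<k}. p i \<ge> m) \<longrightarrow>
        (\<exists>y\<in>X.
          (\<forall>j\<le>n 1. dist ((f ^^ j) y) ((f ^^ j) (x 1)) \<le> \<epsilon>) \<and>
          (\<forall>i\<in>{2..k}. \<forall>j\<le>n i.
             dist ((f ^^ (j + (\<Sum>l\<in>{1..<i}. n l + p l))) y) ((f ^^ j) (x i)) \<le> \<epsilon>))))"

subsection \<open>Baire residual sets\<close>

definition residual_in :: "'a topology \<Rightarrow> 'a set \<Rightarrow> bool" where
  "residual_in T S \<longleftrightarrow> S \<subseteq> topspace T \<and>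
    (\<exists>\<G>. countable \<G> \<and>
      (\<forall>U\<in>\<G>. openin T U \<and> T closure_of U = topspace T) \<and>
      topspace T \<inter> \<Inter>\<G> \<subseteq> S)"

subsection \<open>The weak* topology on Borel probability measures\<close>

definition borel_probs :: "'a::topological_space set \<Rightarrow> 'a measure set" where
  "borel_probs X = {\<mu>. prob_space \<mu> \<and> sets \<mu> = sets (restrict_space borel X)}"

text \<open>The coarsest topology making all maps \<open>\<mu> \<mapsto> \<integral>\<phi> d\<mu>\<close>, for \<open>\<phi>\<close> continuous on \<open>X\<close>,
  continuous.\<close>

definition weak_star_topology :: "'a::topological_space set \<Rightarrow> 'a measure topology" where
  "weak_star_topology X = topology_generated_by
    {{\<mu> \<in> borel_probs X. (\<integral>z. \<phi> z \<partial>\<mu>) \<in> U} | (\<phi> :: 'a \<Rightarrow> real) (U :: real set).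
      continuous_on X \<phi> \<and> open U}"

subsection \<open>Empirical measures and historic behavior\<close>

text \<open>As \<open>measure_of\<close> yields the null measure when its argument is not a measure,
  \<open>emeasure_empirical_measure\<close> below is needed to see that the set function is really attained.\<close>

definition empirical_measure ::
    "'a::topological_space set \<Rightarrow> ('a \<Rightarrow> 'a) \<Rightarrow> nat \<Rightarrow> 'a \<Rightarrow> 'a measure" where
  "empirical_measure X f n x =
    measure_of X (sets (restrict_space borel X))
      (\<lambda>A. ennreal (1 / real n) *
        (\<Sum>j<n. emeasure (return (restrict_space borel X) ((f ^^ j) x)) A))"

definition historic_behavior ::
    "'a::topological_space set \<Rightarrow> ('a \<Rightarrow> 'a) \<Rightarrow> 'a \<Rightarrow> bool" where
  "historic_behavior X f x \<longleftrightarrow>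
    \<not> (\<exists>\<mu>. limitin (weak_star_topology X) (\<lambda>n. empirical_measure X f n x) \<mu> sequentially)"

subsection \<open>Basic facts\<close>

lemma space_restrict_borel [simp]: "space (restrict_space borel X) = X"
  by (simp add: space_restrict_space)

lemma sets_empirical_measure [simp]:
  "sets (empirical_measure X f n x) = sets (restrict_space borel X)"
proof -
  have "sigma_sets X (sets (restrict_space borel X)) = sets (restrict_space borel X)"
    using sets.sigma_sets_eq[of "restrict_space borel X"] by simp
  moreover have "sets (restrict_space borel X) \<subseteq> Pow X"
    using sets.space_closed[of "restrict_space borel X"] by simp
  ultimately show ?thesis
    by (simp add: empirical_measure_def sets_measure_of)
qed

lemma space_empirical_measure [simp]: "space (empirical_measure X f n x) = X"
  using sets_eq_imp_space_eq[OF sets_empirical_measure] by simp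

lemma emeasure_empirical_measure:
  assumes A: "A \<in> sets (restrict_space borel X)"
  shows "emeasure (empirical_measure X f n x) A =
    ennreal (1 / real n) * (\<Sum>j<n. emeasure (return (restrict_space borel X) ((f ^^ j) x)) A)"
    (is "_ = ?\<nu> A")
proof (rule emeasure_measure_of[OF empirical_measure_def])
  let ?B = "restrict_space borel X"
  show "sets ?B \<subseteq> Pow X"
    using sets.space_closed[of ?B] by simp
  show "A \<in> sets (empirical_measure X f n x)"
    using A by simp
  show "positive (sets (empirical_measure X f n x)) ?\<nu>"
    by (simp add: positive_def)
  show "countably_additive (sets (empirical_measure X f n x)) ?\<nu>"
  proof (rule countably_additiveI)
    fix F :: "nat \<Rightarrow> 'a set"
    assume F: "range F \<subseteq> sets (empirical_measure X f n x)" "disjoint_family F"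
    have "(\<Sum>i. emeasure (return ?B ((f ^^ j) x)) (F i)) =
        emeasure (return ?B ((f ^^ j) x)) (\<Union>i. F i)" for j
      by (rule suminf_emeasure) (use F in auto)
    then show "(\<Sum>i. ?\<nu> (F i)) = ?\<nu> (\<Union>i. F i)"
      by (simp add: ennreal_suminf_cmult suminf_sum)
  qed
qed

lemma empirical_measure_in_borel_probs:
  assumes "x \<in> X" "f \<in> X \<rightarrow> X" "n > 0"
  shows "empirical_measure X f n x \<in> borel_probs X"
proof -
  let ?B = "restrict_space borel X"
  have orb: "(f ^^ j) x \<in> X" for j
    by (induction j) (use assms in auto)
  have X: "X \<in> sets ?B"
    using sets.top[of ?B] by simp
  have "emeasure (empirical_measure X f n x) X = ennreal (1 / real n) * of_nat n"
    using orb X by (simp add: emeasure_empirical_measure)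
  also have "\<dots> = 1"
    using assms by (simp add: ennreal_of_nat_eq_real_of_nat flip: ennreal_mult)
  finally have "prob_space (empirical_measure X f n x)"
    by (intro prob_spaceI) simp
  then show ?thesis
    by (simp add: borel_probs_def)
qed

lemma topspace_weak_star_topology [simp]: "topspace (weak_star_topology X) = borel_probs X"
proof -
  have "borel_probs X = {\<mu> \<in> borel_probs X. (\<integral>z. (0::real) \<partial>\<mu>) \<in> UNIV}"
    by simp
  moreover have "continuous_on X (\<lambda>_. 0::real)" "open (UNIV :: real set)"
    by auto
  ultimately show ?thesis
    unfolding weak_star_topology_def topology_generated_by_topspace by blast
qed

lemma limitin_weak_star_topology:
  "limitin (weak_star_topology X) M \<mu> F \<longleftrightarrow>
    \<mu> \<in> borel_probs X \<and> (\<forall>\<^sub>F n in F. M n \<in> borel_probs X) \<and>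
    (\<forall>\<phi>::'a::topological_space \<Rightarrow> real. continuous_on X \<phi> \<longrightarrow>
      ((\<lambda>n. \<integral>z. \<phi> z \<partial>M n) \<longlongrightarrow> (\<integral>z. \<phi> z \<partial>\<mu>)) F)"
  (is "?L \<longleftrightarrow> ?R")
proof
  assume L: ?L
  then have \<mu>: "\<mu> \<in> borel_probs X"
    using limitin_topspace by fastforce
  have "openin (weak_star_topology X) (borel_probs X)"
    using openin_topspace[of "weak_star_topology X"] by simp
  then have "\<forall>\<^sub>F n in F. M n \<in> borel_probs X"
    using L \<mu> by (simp add: limitin_def)
  moreover have "((\<lambda>n. \<integral>z. \<phi> z \<partial>M n) \<longlongrightarrow> (\<integral>z. \<phi> z \<partial>\<mu>)) F"
    if \<phi>: "continuous_on X \<phi>" for \<phi> :: "'a \<Rightarrow> real"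
  proof (rule topological_tendstoI)
    fix U :: "real set"
    assume U: "open U" "(\<integral>z. \<phi> z \<partial>\<mu>) \<in> U"
    have "openin (weak_star_topology X) {\<mu> \<in> borel_probs X. (\<integral>z. \<phi> z \<partial>\<mu>) \<in> U}"
      unfolding weak_star_topology_def
      by (rule topology_generated_by_Basis) (use \<phi> U in blast)
    then have "\<forall>\<^sub>F n in F. M n \<in> {\<mu> \<in> borel_probs X. (\<integral>z. \<phi> z \<partial>\<mu>) \<in> U}"
      using L \<mu> U unfolding limitin_def by blast
    then show "\<forall>\<^sub>F n in F. (\<integral>z. \<phi> z \<partial>M n) \<in> U"
      by (rule eventually_mono) simp
  qed
  ultimately show ?R
    using \<mu> by blast
next
  assume R: ?R
  have "\<mu> \<in> V \<longrightarrow> (\<forall>\<^sub>F n in F. M n \<in> V)"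
    if "generate_topology_on
      {{\<mu> \<in> borel_probs X. (\<integral>z. \<phi> z \<partial>\<mu>) \<in> U} | (\<phi> :: 'a \<Rightarrow> real) (U :: real set).
        continuous_on X \<phi> \<and> open U} V" for V
    using that
  proof (induction rule: generate_topology_on.induct)
    case Empty
    show ?case by simp
  next
    case (Int a b)
    then show ?case by (auto intro: eventually_conj)
  next
    case (UN K)
    show ?case
    proof
      assume "\<mu> \<in> \<Union>K"
      then obtain k where k: "k \<in> K" "\<mu> \<in> k" by blast
      then have "\<forall>\<^sub>F n in F. M n \<in> k" using UN by blast
      then show "\<forall>\<^sub>F n in F. M n \<in> \<Union>K"
        by (rule eventually_mono) (use k in blast)
    qed
  next
    case (Basis s)
    then obtain \<phi> :: "'a \<Rightarrow> real" and U :: "real set"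
      where s: "s = {\<mu> \<in> borel_probs X. (\<integral>z. \<phi> z \<partial>\<mu>) \<in> U}"
        and \<phi>: "continuous_on X \<phi>" and U: "open U" by blast
    show ?case
    proof
      assume "\<mu> \<in> s"
      then have "\<forall>\<^sub>F n in F. (\<integral>z. \<phi> z \<partial>M n) \<in> U"
        using R \<phi> U s topological_tendstoD by fastforce
      moreover have "\<forall>\<^sub>F n in F. M n \<in> borel_probs X"
        using R by blast
      ultimately show "\<forall>\<^sub>F n in F. M n \<in> s"
        unfolding s by (simp add: eventually_conj)
    qed
  qed
  then show ?L
    using R unfolding limitin_def
    by (auto simp: weak_star_topology_def[symmetric] simp flip: openin_topology_generated_by_iff)
qed

end

theory Submission
  imports Defs
begin

text \<open>A continuous observable \<open>\<phi>\<close> obstructs weak* convergence of the empirical measures of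
  \<open>x\<close> as soon as the time averages of \<open>\<phi>\<close> along the orbit of \<open>x\<close> lie infinitely often below
  one level and infinitely often above a strictly larger one.  For a fixed bound \<open>N\<close>, the points
  whose average drops below the lower level at some time \<open>n \<ge> N\<close> form an open set.  This set is
  dense provided that there are points of \<open>X\<close>, possibly different for different times, with still
  lower averages at arbitrarily late times: specification yields a point that starts near any
  prescribed \<open>u\<close> and, after a transition time independent of \<open>n\<close>, follows such a good orbit for
  \<open>n\<close> steps, and for large \<open>n\<close> the transition does not influence the average
  (\<open>low_averages_near_every_point\<close>).  The same holds above the upper level, by passing to \<open>-\<phi>\<close>.

  What remains is to find an observable that has two different time averages
  (\<open>observable_with_two_averages\<close>); this is where specification must exclude unique ergodicity.
  Fix \<open>a \<noteq> b\<close> and a small \<open>\<epsilon>\<close>, and let \<open>m\<close> be a transition time for \<open>\<epsilon>\<close>.  Some orbit is \<open>\<epsilon>\<close>-close to \<open>a\<close> at all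
  multiples of \<open>m\<close>, up to any given time.  Some point \<open>z\<close> is near \<open>b\<close> at the times \<open>i(m+1)\<close>,
  \<open>i < m\<close>, which run through all residues modulo \<open>m\<close>.  Being away from \<open>a\<close> at all those times is
  an open condition, and an orbit of the first kind never meets it, because one of these times,
  counted from any starting moment, falls on a multiple of \<open>m\<close>.  A nonnegative function that is
  positive exactly on this open set thus has average \<open>0\<close> along the first orbit, while an orbit
  that returns periodically to a neighbourhood of \<open>z\<close>, which specification also provides, has
  averages bounded below by a positive constant.\<close>

section \<open>Time averages and empirical measures\<close>

definition birkhoff_sum :: "('a \<Rightarrow> 'a) \<Rightarrow> ('a \<Rightarrow> real) \<Rightarrow> nat \<Rightarrow> 'a \<Rightarrow> real" where
  "birkhoff_sum f \<phi> n x = (\<Sum>j<n. \<phi> ((f ^^ j) x))"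

lemma birkhoff_sum_uminus: "birkhoff_sum f (\<lambda>x. - \<phi> x) n x = - birkhoff_sum f \<phi> n x"
  by (simp add: birkhoff_sum_def sum_negf)

lemma birkhoff_sum_add:
  "birkhoff_sum f \<phi> (m + n) x = birkhoff_sum f \<phi> m x + birkhoff_sum f \<phi> n ((f ^^ m) x)"
proof -
  have "birkhoff_sum f \<phi> (m + n) x =
      (\<Sum>j<m. \<phi> ((f ^^ j) x)) + (\<Sum>j<n. \<phi> ((f ^^ (m + j)) x))"
    unfolding birkhoff_sum_def by (induction n) auto
  then show ?thesis
    by (simp add: birkhoff_sum_def funpow_add add.commute[of m])
qed

lemma funpow_closed:
  assumes "f \<in> X \<rightarrow> X" "x \<in> X"
  shows "(f ^^ j) x \<in> X"
  using assms by (induction j) auto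

lemma continuous_on_funpow:
  assumes "f \<in> X \<rightarrow> X" "continuous_on X f"
  shows "continuous_on X (f ^^ j)"
proof (induction j)
  case 0
  show ?case by simp
next
  case (Suc j)
  have "(f ^^ j) ` X \<subseteq> X"
    using funpow_closed[OF assms(1)] by blast
  then have "continuous_on X (f \<circ> f ^^ j)"
    using Suc assms(2) continuous_on_compose continuous_on_subset by blast
  then show ?case by simp
qed

lemma continuous_on_birkhoff_sum:
  assumes "f \<in> X \<rightarrow> X" "continuous_on X f" "continuous_on X \<phi>"
  shows "continuous_on X (birkhoff_sum f \<phi> n)"
  unfolding birkhoff_sum_def
proof (intro continuous_on_sum)
  fix j
  show "continuous_on X (\<lambda>x. \<phi> ((f ^^ j) x))"
    by (rule continuous_on_compose2[OF assms(3) continuous_on_funpow[OF assms(1,2)]])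
      (use funpow_closed[OF assms(1)] in blast)
qed

lemma empirical_measure_eq_distr:
  assumes "x \<in> X" "f \<in> X \<rightarrow> X" "n > 0"
  shows "empirical_measure X f n x =
    distr (uniform_count_measure {..<n}) (restrict_space borel X) (\<lambda>j. (f ^^ j) x)"
    (is "_ = distr ?U ?B ?g")
proof (rule measure_eqI)
  fix A assume "A \<in> sets (empirical_measure X f n x)"
  then have A: "A \<in> sets ?B" by simp
  have g: "?g \<in> measurable ?U ?B"
    using funpow_closed[OF assms(2,1)]
    by (auto simp: measurable_def sets_uniform_count_measure space_uniform_count_measure)
  have "emeasure (empirical_measure X f n x) A =
      ennreal (1 / n) * (\<Sum>j<n. indicator A (?g j))"
    using A by (simp add: emeasure_empirical_measure)
  also have "(\<Sum>j<n. indicator A (?g j) :: ennreal) = of_nat (card (?g -` A \<inter> {..<n}))"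
    by (subst sum.cong[OF refl, of _ _ "indicator (?g -` A)"])
      (auto simp: indicator_def sum.If_cases Int_commute vimage_def Collect_conj_eq)
  also have "ennreal (1 / n) * \<dots> = ennreal (card (?g -` A \<inter> {..<n}) / n)"
    using assms(3) by (simp add: ennreal_of_nat_eq_real_of_nat flip: ennreal_mult)
  also have "\<dots> = emeasure (distr ?U ?B ?g) A"
    using A g by (simp add: emeasure_distr space_uniform_count_measure
        emeasure_uniform_count_measure)
  finally show "emeasure (empirical_measure X f n x) A = emeasure (distr ?U ?B ?g) A" .
qed simp

lemma integral_empirical_measure:
  fixes \<phi> :: "'a::topological_space \<Rightarrow> real"
  assumes "x \<in> X" "f \<in> X \<rightarrow> X" "n > 0" "continuous_on X \<phi>"
  shows "(\<integral>z. \<phi> z \<partial>empirical_measure X f n x) = birkhoff_sum f \<phi> n x / n"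
proof -
  have g: "(\<lambda>j. (f ^^ j) x) \<in> measurable (uniform_count_measure {..<n}) (restrict_space borel X)"
    using funpow_closed[OF assms(2,1)]
    by (auto simp: measurable_def sets_uniform_count_measure space_uniform_count_measure)
  have "\<phi> \<in> borel_measurable (restrict_space borel X)"
    using assms(4) by (rule borel_measurable_continuous_on_restrict)
  with g show ?thesis
    unfolding empirical_measure_eq_distr[OF assms(1-3)]
    by (simp add: integral_distr integral_uniform_count_measure birkhoff_sum_def)
qed

lemma historic_behavior_if_averages_oscillate:
  fixes \<alpha> \<beta> :: real
  assumes x: "x \<in> X" and f: "f \<in> X \<rightarrow> X" and \<phi>: "continuous_on X \<phi>" and "\<alpha> < \<beta>"
    and low: "\<And>N. \<exists>n\<ge>N. birkhoff_sum f \<phi> n x < \<alpha> * n"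
    and high: "\<And>N. \<exists>n\<ge>N. birkhoff_sum f \<phi> n x > \<beta> * n"
  shows "historic_behavior X f x"
  unfolding historic_behavior_def
proof
  assume "\<exists>\<mu>. limitin (weak_star_topology X) (\<lambda>n. empirical_measure X f n x) \<mu> sequentially"
  then obtain \<mu> where
    "(\<lambda>n. \<integral>z. \<phi> z \<partial>empirical_measure X f n x) \<longlonglongrightarrow> (\<integral>z. \<phi> z \<partial>\<mu>)"
    using \<phi> unfolding limitin_weak_star_topology by blast
  moreover have "\<forall>\<^sub>F n in sequentially.
      (\<integral>z. \<phi> z \<partial>empirical_measure X f n x) = birkhoff_sum f \<phi> n x / n"
    using eventually_gt_at_top[of 0]
    by eventually_elim (use integral_empirical_measure[OF x f _ \<phi>] in simp)
  ultimately have lim: "(\<lambda>n. birkhoff_sum f \<phi> n x / n) \<longlonglongrightarrow> (\<integral>z. \<phi> z \<partial>\<mu>)" (is "_ \<longlonglongrightarrow> ?L")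
    by (rule Lim_transform_eventually)
  consider "?L < \<beta>" | "\<alpha> < ?L"
    using \<open>\<alpha> < \<beta>\<close> by linarith
  then show False
  proof cases
    case 1
    then obtain N where N: "\<And>n. n \<ge> N \<Longrightarrow> birkhoff_sum f \<phi> n x / n < \<beta>"
      using order_tendstoD(2)[OF lim] unfolding eventually_sequentially by blast
    obtain n where "n \<ge> Suc N" "birkhoff_sum f \<phi> n x > \<beta> * n"
      using high by blast
    with N[of n] show False
      by (simp add: field_simps)
  next
    case 2
    then obtain N where N: "\<And>n. n \<ge> N \<Longrightarrow> \<alpha> < birkhoff_sum f \<phi> n x / n"
      using order_tendstoD(1)[OF lim] unfolding eventually_sequentially by blast
    obtain n where "n \<ge> Suc N" "birkhoff_sum f \<phi> n x < \<alpha> * n"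
      using low by blast
    with N[of n] show False
      by (simp add: field_simps)
  qed
qed

section \<open>Two instances of specification\<close>

definition transition_time :: "'a::metric_space set \<Rightarrow> ('a \<Rightarrow> 'a) \<Rightarrow> real \<Rightarrow> nat \<Rightarrow> bool" where
  "transition_time X f \<epsilon> m \<longleftrightarrow> m \<ge> 1 \<and>
    (\<forall>k\<ge>1. \<forall>(x :: nat \<Rightarrow> 'a) (n :: nat \<Rightarrow> nat) (p :: nat \<Rightarrow> nat).
      (\<forall>i\<in>{1..k}. x i \<in> X) \<longrightarrow> (\<forall>i\<in>{1..<k}. p i \<ge> m) \<longrightarrow>
      (\<exists>y\<in>X.
        (\<forall>j\<le>n 1. dist ((f ^^ j) y) ((f ^^ j) (x 1)) \<le> \<epsilon>) \<and>
        (\<forall>i\<in>{2..k}. \<forall>j\<le>n i.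
           dist ((f ^^ (j + (\<Sum>l\<in>{1..<i}. n l + p l))) y) ((f ^^ j) (x i)) \<le> \<epsilon>)))"

lemma specification_property_iff:
  "specification_property X f \<longleftrightarrow> (\<forall>\<epsilon>>0. \<exists>m. transition_time X f \<epsilon> m)"
  unfolding specification_property_def transition_time_def by (rule refl)

lemma transition_timeD:
  fixes n p :: "nat \<Rightarrow> nat" and k :: nat
  assumes "transition_time X f \<epsilon> m" "k \<ge> 1" "\<And>i. i \<in> {1..k} \<Longrightarrow> x i \<in> X"
    "\<And>i. i \<in> {1..<k} \<Longrightarrow> p i \<ge> m"
  obtains y where "y \<in> X" "\<And>j. j \<le> n 1 \<Longrightarrow> dist ((f ^^ j) y) ((f ^^ j) (x 1)) \<le> \<epsilon>"
    "\<And>i j. i \<in> {2..k} \<Longrightarrow> j \<le> n i \<Longrightarrow>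
      dist ((f ^^ (j + (\<Sum>l\<in>{1..<i}. n l + p l))) y) ((f ^^ j) (x i)) \<le> \<epsilon>"
proof -
  have "(\<forall>i\<in>{1..k}. x i \<in> X) \<longrightarrow> (\<forall>i\<in>{1..<k}. p i \<ge> m) \<longrightarrow>
      (\<exists>y\<in>X.
        (\<forall>j\<le>n 1. dist ((f ^^ j) y) ((f ^^ j) (x 1)) \<le> \<epsilon>) \<and>
        (\<forall>i\<in>{2..k}. \<forall>j\<le>n i.
           dist ((f ^^ (j + (\<Sum>l\<in>{1..<i}. n l + p l))) y) ((f ^^ j) (x i)) \<le> \<epsilon>))"
    using assms(1,2) unfolding transition_time_def by blast
  with assms(3,4) that show thesis by blast
qed

text \<open>What makes this useful for averages is the order of choice: \<open>m\<close> is fixed before the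
  length \<open>n\<close> of the second orbit piece.\<close>

lemma specification_join:
  assumes "specification_property X f" "\<epsilon> > 0"
  obtains m where "\<And>u w n. u \<in> X \<Longrightarrow> w \<in> X \<Longrightarrow>
    \<exists>y\<in>X. dist y u \<le> \<epsilon> \<and> (\<forall>j\<le>n. dist ((f ^^ j) ((f ^^ m) y)) ((f ^^ j) w) \<le> \<epsilon>)"
proof -
  obtain m where m: "transition_time X f \<epsilon> m"
    using assms unfolding specification_property_iff by blast
  show thesis
  proof (rule that[of m])
    fix u w and n :: nat assume uw: "u \<in> X" "w \<in> X"
    let ?x = "\<lambda>i::nat. if i = 1 then u else w"
    let ?n = "\<lambda>i::nat. if i = 1 then 0 else (n::nat)"
    obtain y where y: "y \<in> X" "\<And>j. j \<le> ?n 1 \<Longrightarrow> dist ((f ^^ j) y) ((f ^^ j) (?x 1)) \<le> \<epsilon>"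
      "\<And>i j. i \<in> {2..2} \<Longrightarrow> j \<le> ?n i \<Longrightarrow>
        dist ((f ^^ (j + (\<Sum>l\<in>{1..<i}. ?n l + m))) y) ((f ^^ j) (?x i)) \<le> \<epsilon>"
      by (rule transition_timeD[OF m, of 2 ?x "\<lambda>_. m" ?n]) (use uw in auto)
    have "(\<Sum>l\<in>{1..<2::nat}. ?n l + m) = m"
      by (simp add: numeral_2_eq_2)
    then have "dist ((f ^^ j) ((f ^^ m) y)) ((f ^^ j) w) \<le> \<epsilon>" if "j \<le> n" for j
      using y(3)[of 2 j] that by (simp add: funpow_add)
    moreover have "dist y u \<le> \<epsilon>" using y(2)[of 0] by simp
    ultimately
    show "\<exists>y\<in>X. dist y u \<le> \<epsilon> \<and> (\<forall>j\<le>n. dist ((f ^^ j) ((f ^^ m) y)) ((f ^^ j) w) \<le> \<epsilon>)"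
      using y(1) by blast
  qed
qed

text \<open>All orbit pieces are the single point \<open>z\<close>.  The freedom to take any period \<open>q \<ge> m\<close>
  matters: the two coprime periods \<open>m\<close> and \<open>m + 1\<close> are played off against each other in
  \<open>observable_with_two_averages\<close>.\<close>

lemma specification_periodic_visits:
  assumes "specification_property X f" "\<epsilon> > 0"
  obtains m :: nat where "m \<ge> 1" "\<And>z q k. z \<in> X \<Longrightarrow> q \<ge> m \<Longrightarrow>
    \<exists>y\<in>X. \<forall>i<k. dist ((f ^^ (i * q)) y) z \<le> \<epsilon>"
proof -
  obtain m where m: "transition_time X f \<epsilon> m"
    using assms unfolding specification_property_iff by blast
  show thesis
  proof (rule that[of m])
    show "m \<ge> 1" using m unfolding transition_time_def by blast
    fix z q and k :: nat assume zq: "z \<in> X" "q \<ge> m"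
    obtain y where y: "y \<in> X" "\<And>j. j \<le> 0 \<Longrightarrow> dist ((f ^^ j) y) ((f ^^ j) z) \<le> \<epsilon>"
      "\<And>i j. i \<in> {2..Suc k} \<Longrightarrow> j \<le> 0 \<Longrightarrow>
        dist ((f ^^ (j + (\<Sum>l\<in>{1..<i}. 0 + q))) y) ((f ^^ j) z) \<le> \<epsilon>"
      by (rule transition_timeD[OF m, of "Suc k" "\<lambda>_. z" "\<lambda>_. q" "\<lambda>_. 0"]) (use zq in auto)
    have "dist ((f ^^ (i * q)) y) z \<le> \<epsilon>" if "i < k" for i
    proof (cases "i = 0")
      case True
      then show ?thesis using y(2)[of 0] by simp
    next
      case False
      then show ?thesis using y(3)[of "Suc i" 0] that by simp
    qed
    with y(1) show "\<exists>y\<in>X. \<forall>i<k. dist ((f ^^ (i * q)) y) z \<le> \<epsilon>" by blast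
  qed
qed

section \<open>An observable with two different time averages\<close>

lemma observable_with_two_averages:
  fixes X :: "'a::metric_space set"
  assumes f: "f \<in> X \<rightarrow> X" "continuous_on X f"
    and spec: "specification_property X f"
    and ab: "a \<in> X" "b \<in> X" "a \<noteq> b"
  obtains \<phi> :: "'a \<Rightarrow> real" and \<gamma> :: real where "continuous_on X \<phi>" "\<gamma> > 0"
    "\<And>N. \<exists>n\<ge>N. \<exists>x\<in>X. birkhoff_sum f \<phi> n x \<le> 0"
    "\<And>N. \<exists>n\<ge>N. \<exists>x\<in>X. birkhoff_sum f \<phi> n x \<ge> \<gamma> * n"
proof -
  \<comment> \<open>A third, not a half: a point \<open>\<epsilon>\<close>-close to \<open>b\<close> must be strictly farther than \<open>\<epsilon>\<close> from \<open>a\<close>.\<close>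
  define \<epsilon> where "\<epsilon> = dist a b / 3"
  have \<epsilon>: "\<epsilon> > 0" using ab by (simp add: \<epsilon>_def)
  obtain m where m: "m \<ge> 1" "\<And>z q k. z \<in> X \<Longrightarrow> q \<ge> m \<Longrightarrow>
      \<exists>y\<in>X. \<forall>i<k. dist ((f ^^ (i * q)) y) z \<le> \<epsilon>"
    using specification_periodic_visits[OF spec \<epsilon>] by blast
  define \<phi> where "\<phi> x = (\<Prod>i<m. max 0 (dist ((f ^^ (i * (m + 1))) x) a - \<epsilon>))" for x
  have \<phi>_cont: "continuous_on X \<phi>"
    unfolding \<phi>_def by (intro continuous_intros continuous_on_funpow f)
  have \<phi>_nonneg: "\<phi> x \<ge> 0" for x
    unfolding \<phi>_def by (intro prod_nonneg) simp
  have low: "\<exists>n\<ge>N. \<exists>x\<in>X. birkhoff_sum f \<phi> n x \<le> 0" for N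
  proof -
    obtain y where y: "y \<in> X" "\<And>i. i < N + 2 * m + 1 \<Longrightarrow> dist ((f ^^ (i * m)) y) a \<le> \<epsilon>"
      using m(2)[OF ab(1) order.refl] by blast
    have "\<phi> ((f ^^ t) y) = 0" if t: "t < N" for t
    proof -
      \<comment> \<open>As \<open>m + 1\<close> is congruent to \<open>1\<close> modulo \<open>m\<close>, the index to use is the residue of \<open>-t\<close>.\<close>
      define i where "i = (m - t mod m) mod m"
      have "i < m" using m(1) by (simp add: i_def)
      have "(t + i) mod m = (t mod m + (m - t mod m)) mod m"
        unfolding i_def by (simp add: mod_simps)
      also have "\<dots> = 0"
        using m(1) by (simp add: less_imp_le)
      finally obtain q where q: "t + i = m * q" by auto
      have "i * (m + 1) + t = (q + i) * m"
        using q by (simp add: algebra_simps)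
      moreover have "q + i < N + 2 * m + 1"
      proof -
        have "q \<le> m * q" using m(1) by simp
        then show ?thesis using q t \<open>i < m\<close> by linarith
      qed
      ultimately have "dist ((f ^^ (i * (m + 1))) ((f ^^ t) y)) a \<le> \<epsilon>"
        using y(2)[of "q + i"] by (metis comp_apply funpow_add)
      then show ?thesis
        unfolding \<phi>_def using \<open>i < m\<close> by (intro prod_zero bexI[of _ i]) auto
    qed
    then have "birkhoff_sum f \<phi> N y = 0"
      by (simp add: birkhoff_sum_def)
    with y(1) show ?thesis by (metis order.refl)
  qed
  obtain z where z: "z \<in> X" "\<And>i. i < m \<Longrightarrow> dist ((f ^^ (i * (m + 1))) z) b \<le> \<epsilon>"
    using m(2)[OF ab(2), of "m + 1" m] by auto
  have "\<phi> z > 0"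
    unfolding \<phi>_def
  proof (intro prod_pos)
    fix i assume "i \<in> {..<m}"
    then have "dist ((f ^^ (i * (m + 1))) z) b \<le> \<epsilon>" using z by simp
    moreover have "dist a b \<le> dist ((f ^^ (i * (m + 1))) z) a + dist ((f ^^ (i * (m + 1))) z) b"
      by (rule dist_triangle3)
    ultimately show "0 < max 0 (dist ((f ^^ (i * (m + 1))) z) a - \<epsilon>)"
      using \<epsilon> unfolding \<epsilon>_def by linarith
  qed
  then obtain r where r: "r > 0" "\<And>x. x \<in> X \<Longrightarrow> dist x z < r \<Longrightarrow> dist (\<phi> x) (\<phi> z) < \<phi> z / 2"
    using \<phi>_cont z(1) unfolding continuous_on_iff by (metis half_gt_zero)
  have near_z: "\<phi> x \<ge> \<phi> z / 2" if "x \<in> X" "dist x z \<le> r / 2" for x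
    using r(2)[of x] that r(1) unfolding dist_real_def by linarith
  obtain q where q: "q \<ge> 1" "\<And>k. \<exists>y\<in>X. \<forall>i<k. dist ((f ^^ (i * q)) y) z \<le> r / 2"
    using specification_periodic_visits[OF spec, of "r / 2"] z(1) r(1)
    by (metis half_gt_zero order.refl)
  \<comment> \<open>An orbit near \<open>z\<close> at all multiples of \<open>q\<close> collects at least \<open>\<phi> z / 2\<close> per \<open>q\<close> steps.\<close>
  define \<gamma> where "\<gamma> = \<phi> z / (2 * q)"
  have high: "\<exists>n\<ge>N. \<exists>x\<in>X. birkhoff_sum f \<phi> n x \<ge> \<gamma> * n" for N
  proof -
    obtain y where y: "y \<in> X" "\<And>i. i < N \<Longrightarrow> dist ((f ^^ (i * q)) y) z \<le> r / 2"
      using q(2) by blast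
    have "\<gamma> * (N * q) = (\<Sum>i<N. \<phi> z / 2)"
      using q(1) by (simp add: \<gamma>_def field_simps)
    also have "\<dots> \<le> (\<Sum>i<N. \<phi> ((f ^^ (i * q)) y))"
      by (intro sum_mono near_z y(2) funpow_closed[OF f(1) y(1)]) simp
    also have "\<dots> = (\<Sum>j\<in>(\<lambda>i. i * q) ` {..<N}. \<phi> ((f ^^ j) y))"
      using q(1) by (subst sum.reindex) (auto simp: inj_on_def)
    also have "\<dots> \<le> birkhoff_sum f \<phi> (N * q) y"
      unfolding birkhoff_sum_def using q(1)
      by (intro sum_mono2) (auto simp: \<phi>_nonneg)
    finally have "birkhoff_sum f \<phi> (N * q) y \<ge> \<gamma> * real (N * q)" by simp
    moreover have "N * q \<ge> N" using q(1) by simp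
    ultimately show ?thesis using y(1) by blast
  qed
  have "\<gamma> > 0"
    using \<open>\<phi> z > 0\<close> q(1) by (simp add: \<gamma>_def)
  from that[OF \<phi>_cont this low high] show thesis .
qed

section \<open>Density of points with extreme averages\<close>

text \<open>The good orbit is reached after a transition time that depends on the accuracy of the
  shadowing but not on how long the orbit is followed, so the cost of the transition is
  bounded and becomes negligible against \<open>(\<beta> - \<alpha>) * n\<close>.\<close>

lemma low_averages_near_every_point:
  fixes X :: "'a::metric_space set" and \<alpha> \<beta> :: real
  assumes X: "compact X" and f: "f \<in> X \<rightarrow> X"
    and spec: "specification_property X f" and \<phi>: "continuous_on X \<phi>"
    and low: "\<And>N. \<exists>n\<ge>N. \<exists>x\<in>X. birkhoff_sum f \<phi> n x \<le> \<alpha> * n"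
    and "\<alpha> < \<beta>" and u: "u \<in> X" and r: "r > 0"
  shows "\<exists>n\<ge>N. \<exists>y\<in>X. dist y u \<le> r \<and> birkhoff_sum f \<phi> n y < \<beta> * n"
proof -
  define \<delta> where "\<delta> = (\<beta> - \<alpha>) / 2"
  have \<delta>: "\<delta> > 0" using \<open>\<alpha> < \<beta>\<close> by (simp add: \<delta>_def)
  have "uniformly_continuous_on X \<phi>"
    using \<phi> X by (rule compact_uniformly_continuous)
  then obtain \<eta> where \<eta>: "\<eta> > 0"
    "\<And>x y. x \<in> X \<Longrightarrow> y \<in> X \<Longrightarrow> dist y x < \<eta> \<Longrightarrow> dist (\<phi> y) (\<phi> x) < \<delta>"
    using \<delta> unfolding uniformly_continuous_on_def by metis
  have "bounded (\<phi> ` X)"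
    using compact_continuous_image[OF \<phi> X] by (rule compact_imp_bounded)
  then obtain B where B: "\<And>x. x \<in> X \<Longrightarrow> \<bar>\<phi> x\<bar> \<le> B"
    unfolding bounded_iff by auto
  define \<epsilon> where "\<epsilon> = min (\<eta> / 2) r"
  have \<epsilon>: "\<epsilon> > 0" "\<epsilon> < \<eta>" "\<epsilon> \<le> r" using \<eta>(1) r by (auto simp: \<epsilon>_def)
  obtain m where m: "\<And>u w n. u \<in> X \<Longrightarrow> w \<in> X \<Longrightarrow>
      \<exists>y\<in>X. dist y u \<le> \<epsilon> \<and> (\<forall>j\<le>n. dist ((f ^^ j) ((f ^^ m) y)) ((f ^^ j) w) \<le> \<epsilon>)"
    using specification_join[OF spec \<epsilon>(1)] by blast
  obtain M :: nat where M: "M > m * (B - \<beta>) / \<delta>"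
    using reals_Archimedean2 by blast
  obtain n w where n: "n \<ge> max N M" and w: "w \<in> X" "birkhoff_sum f \<phi> n w \<le> \<alpha> * n"
    using low by blast
  obtain y where y: "y \<in> X" "dist y u \<le> \<epsilon>"
    and shadow: "\<And>j. j \<le> n \<Longrightarrow> dist ((f ^^ j) ((f ^^ m) y)) ((f ^^ j) w) \<le> \<epsilon>"
    using m[OF u w(1)] by blast
  have "birkhoff_sum f \<phi> m y \<le> (\<Sum>j<m. B)"
    unfolding birkhoff_sum_def
    by (intro sum_mono) (use B funpow_closed[OF f y(1)] in \<open>auto simp: abs_le_iff\<close>)
  then have start: "birkhoff_sum f \<phi> m y \<le> m * B" by simp
  have "birkhoff_sum f \<phi> n ((f ^^ m) y) \<le> (\<Sum>j<n. \<phi> ((f ^^ j) w) + \<delta>)"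
    unfolding birkhoff_sum_def
  proof (intro sum_mono)
    fix j assume "j \<in> {..<n}"
    then have "dist (\<phi> ((f ^^ j) ((f ^^ m) y))) (\<phi> ((f ^^ j) w)) < \<delta>"
      using shadow[of j] \<epsilon>(2) by (intro \<eta>(2) funpow_closed[OF f] w(1) y(1)) auto
    then show "\<phi> ((f ^^ j) ((f ^^ m) y)) \<le> \<phi> ((f ^^ j) w) + \<delta>"
      unfolding dist_real_def by linarith
  qed
  also have "\<dots> = birkhoff_sum f \<phi> n w + n * \<delta>"
    by (simp add: birkhoff_sum_def sum.distrib)
  finally have rest: "birkhoff_sum f \<phi> n ((f ^^ m) y) \<le> \<alpha> * n + n * \<delta>"
    using w(2) by linarith
  have "real n > m * (B - \<beta>) / \<delta>"
    using M n by (smt (verit) max.boundedE of_nat_le_iff)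
  then have "m * (B - \<beta>) < n * \<delta>"
    using \<delta> by (simp add: divide_simps)
  moreover have "\<beta> * n = \<alpha> * n + n * \<delta> + n * \<delta>"
    by (simp add: \<delta>_def field_simps)
  ultimately have "birkhoff_sum f \<phi> (m + n) y < \<beta> * (m + n)"
    using start rest by (simp add: birkhoff_sum_add algebra_simps)
  moreover have "m + n \<ge> N" using n by simp
  moreover have "dist y u \<le> r" using y(2) \<epsilon>(3) by linarith
  ultimately show ?thesis using y(1) by blast
qed

lemma low_averages_open_dense:
  fixes X :: "'a::metric_space set" and \<alpha> \<beta> :: real and N :: nat
  assumes X: "compact X" and f: "f \<in> X \<rightarrow> X" "continuous_on X f"
    and spec: "specification_property X f" and \<phi>: "continuous_on X \<phi>"
    and low: "\<And>N. \<exists>n\<ge>N. \<exists>x\<in>X. birkhoff_sum f \<phi> n x \<le> \<alpha> * n"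
    and "\<alpha> < \<beta>"
  defines "V \<equiv> {x \<in> X. \<exists>n\<ge>N. birkhoff_sum f \<phi> n x < \<beta> * real n}"
  shows "openin (top_of_set X) V \<and> (top_of_set X) closure_of V = topspace (top_of_set X)"
proof
  have "openin (top_of_set X) (X \<inter> birkhoff_sum f \<phi> n -` {..<\<beta> * n})" for n
    by (rule continuous_openin_preimage_gen[OF continuous_on_birkhoff_sum[OF f \<phi>]]) simp
  then have "openin (top_of_set X) (\<Union>n\<in>{N..}. X \<inter> birkhoff_sum f \<phi> n -` {..<\<beta> * n})"
    by blast
  also have "(\<Union>n\<in>{N..}. X \<inter> birkhoff_sum f \<phi> n -` {..<\<beta> * n}) = V"
    unfolding V_def by auto
  finally show "openin (top_of_set X) V" .
  show "(top_of_set X) closure_of V = topspace (top_of_set X)"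
    unfolding dense_intersects_open
  proof (intro allI impI, elim conjE)
    fix T assume T: "openin (top_of_set X) T" "T \<noteq> {}"
    then obtain u where u: "u \<in> T" by blast
    then have uX: "u \<in> X" using T(1) openin_imp_subset by blast
    obtain e where e: "e > 0" "\<And>y. y \<in> X \<Longrightarrow> dist y u < e \<Longrightarrow> y \<in> T"
      using T(1) u unfolding openin_euclidean_subtopology_iff by blast
    obtain n y where "n \<ge> N" "y \<in> X" "dist y u \<le> e / 2" "birkhoff_sum f \<phi> n y < \<beta> * n"
      using low_averages_near_every_point[OF X f(1) spec \<phi> low \<open>\<alpha> < \<beta>\<close> uX, of "e / 2" N] e(1)
      by auto
    moreover from this e have "y \<in> T" by simp
    ultimately show "V \<inter> T \<noteq> {}"
      unfolding V_def by blast
  qed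
qed

theorem corollary2:
  fixes X :: "'a::metric_space set" and f :: "'a \<Rightarrow> 'a"
  assumes "compact X"
    and "\<nexists>a. X = {a}"
    and "f \<in> X \<rightarrow> X"
    and "continuous_on X f"
    and "specification_property X f"
  shows "\<exists>R. residual_in (top_of_set X) R \<and> (\<forall>x\<in>R. historic_behavior X f x)"
proof (cases "X = {}")
  case True
  then have "residual_in (top_of_set X) {}"
    by (auto simp: residual_in_def intro: exI[of _ "{}"])
  then show ?thesis by blast
next
  case False
  then obtain a b where "a \<in> X" "b \<in> X" "a \<noteq> b"
    using assms(2) by blast
  then obtain \<phi> and \<gamma> :: real where \<phi>: "continuous_on X \<phi>" and \<gamma>: "\<gamma> > 0"
    and low: "\<And>N. \<exists>n\<ge>N. \<exists>x\<in>X. birkhoff_sum f \<phi> n x \<le> 0"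
    and high: "\<And>N. \<exists>n\<ge>N. \<exists>x\<in>X. birkhoff_sum f \<phi> n x \<ge> \<gamma> * n"
    using observable_with_two_averages[OF assms(3-5)] by metis
  define L where "L N = {x \<in> X. \<exists>n\<ge>N. birkhoff_sum f \<phi> n x < \<gamma> / 3 * n}" for N :: nat
  define H where
    "H N = {x \<in> X. \<exists>n\<ge>N. birkhoff_sum f (\<lambda>x. - \<phi> x) n x < - (2 * \<gamma> / 3) * n}" for N :: nat
  have "openin (top_of_set X) (L N) \<and> (top_of_set X) closure_of L N = topspace (top_of_set X)"
    for N
    unfolding L_def
    by (rule low_averages_open_dense[OF assms(1,3-5) \<phi>, of 0]) (use low \<gamma> in auto)
  moreover have
    "openin (top_of_set X) (H N) \<and> (top_of_set X) closure_of H N = topspace (top_of_set X)" for N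
    unfolding H_def
    by (rule low_averages_open_dense[OF assms(1,3-5), of _ "- \<gamma>"])
      (use \<phi> high \<gamma> in \<open>auto simp: birkhoff_sum_uminus intro: continuous_on_minus\<close>)
  ultimately have "residual_in (top_of_set X) (X \<inter> \<Inter>(range L \<union> range H))"
    unfolding residual_in_def by (intro conjI exI[of _ "range L \<union> range H"]) auto
  moreover have "historic_behavior X f x" if x: "x \<in> X \<inter> \<Inter>(range L \<union> range H)" for x
  proof (rule historic_behavior_if_averages_oscillate[OF _ assms(3) \<phi>])
    show "x \<in> X" using x by blast
    show "\<gamma> / 3 < 2 * \<gamma> / 3" using \<gamma> by simp
    show "\<exists>n\<ge>N. birkhoff_sum f \<phi> n x < \<gamma> / 3 * n" for N
      using x unfolding L_def by blast
    have "x \<in> H N" for N using x by blast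
    then show "\<exists>n\<ge>N. birkhoff_sum f \<phi> n x > 2 * \<gamma> / 3 * n" for N
      unfolding H_def by (simp add: birkhoff_sum_uminus)
  qed
  ultimately show ?thesis by blast
qed

end
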